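(* For all positive integers $n,k,D,\alpha$ such that $k/(8D\alpha)$ is an integer and $n\geq 3k\cdot\left(\frac{k}{4D\alpha}\right)^D$, there exists a $k$-edge-connected simple graph $G$ on $n$ vertices of diameter at most $2D+2$, such that, for any collection $\mathcal{T}=\{T_1,\ldots,T_{k/\alpha}\}$ of $k/\alpha$ edge-independent spanning trees of $G$, some tree $T_i\in\mathcal{T}$ has diameter at least $\frac14\cdot\left(\frac{k}{4D\alpha}\right)^D$.
   Context: Graphs are finite, undirected and unweighted; a simple graph has no loops and no parallel edges. A graph is $k$-edge-connected if it remains connected after deletion of any set of at most $k-1$ edges. A collection $\mathcal{T}$ of spanning trees of $G$ is edge-independent if all trees of $\mathcal{T}$ are rooted at the same vertex $v^*$, and for every vertex $v\in V(G)$, the paths connecting $v$ to $v^*$ in the trees $T\in\mathcal{T}$ (one path per tree) are pairwise edge-disjoint. *)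

theory Defs
  imports "HOL-Library.Extended_Real"
begin

record 'a graph =
  verts :: "'a set"
  edges :: "'a set set"

definition simple_graph :: "'a graph \<Rightarrow> bool" where
  "simple_graph G \<longleftrightarrow>
     finite (verts G) \<and> (\<forall>e\<in>edges G. e \<subseteq> verts G \<and> card e = 2)"

(* A path is given by its list of vertices; the singleton list is the trivial path. *)
definition is_path :: "'a graph \<Rightarrow> 'a \<Rightarrow> 'a list \<Rightarrow> 'a \<Rightarrow> bool" where
  "is_path G u p v \<longleftrightarrow>
     p \<noteq> [] \<and> hd p = u \<and> last p = v \<and> distinct p \<and> set p \<subseteq> verts G \<and>
     successively (\<lambda>x y. {x, y} \<in> edges G) p"

definition path_edges :: "'a list \<Rightarrow> 'a set set" where
  "path_edges p = {{p ! i, p ! Suc i} | i. Suc i < length p}"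

definition connected_graph :: "'a graph \<Rightarrow> bool" where
  "connected_graph G \<longleftrightarrow>
     verts G \<noteq> {} \<and> (\<forall>u\<in>verts G. \<forall>v\<in>verts G. \<exists>p. is_path G u p v)"

definition edge_connected :: "nat \<Rightarrow> 'a graph \<Rightarrow> bool" where
  "edge_connected k G \<longleftrightarrow>
     (\<forall>F. F \<subseteq> edges G \<and> card F < k \<longrightarrow> connected_graph (G\<lparr>edges := edges G - F\<rparr>))"

(* The distance is infinite if there is no path, since the infimum of the empty set is top. *)
definition graph_dist :: "'a graph \<Rightarrow> 'a \<Rightarrow> 'a \<Rightarrow> enat" where
  "graph_dist G u v = (INF p\<in>{p. is_path G u p v}. enat (length p - 1))"

definition graph_diameter :: "'a graph \<Rightarrow> enat" where
  "graph_diameter G = (SUP u\<in>verts G. SUP v\<in>verts G. graph_dist G u v)"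

(* A cycle is a path on at least three vertices whose end points are adjacent. *)
definition acyclic_graph :: "'a graph \<Rightarrow> bool" where
  "acyclic_graph G \<longleftrightarrow>
     \<not> (\<exists>u p v. is_path G u p v \<and> length p \<ge> 3 \<and> {v, u} \<in> edges G)"

definition is_tree :: "'a graph \<Rightarrow> bool" where
  "is_tree T \<longleftrightarrow> simple_graph T \<and> connected_graph T \<and> acyclic_graph T"

definition is_spanning_tree :: "'a graph \<Rightarrow> 'a graph \<Rightarrow> bool" where
  "is_spanning_tree T G \<longleftrightarrow> is_tree T \<and> verts T = verts G \<and> edges T \<subseteq> edges G"

(* Collections of trees are indexed families. Paths in a tree are unique, so quantifying
   over all paths from v to the root r in T i is the same as taking the path. *)
definition edge_independent_spanning_trees ::
    "'a graph \<Rightarrow> 'i set \<Rightarrow> ('i \<Rightarrow> 'a graph) \<Rightarrow> bool" where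
  "edge_independent_spanning_trees G I T \<longleftrightarrow>
     (\<forall>i\<in>I. is_spanning_tree (T i) G) \<and>
     (\<exists>r\<in>verts G. \<forall>v\<in>verts G. \<forall>i\<in>I. \<forall>j\<in>I. i \<noteq> j \<longrightarrow>
        (\<forall>p q. is_path (T i) v p r \<and> is_path (T j) v q r \<longrightarrow>
           path_edges p \<inter> path_edges q = {}))"

end

theory Submission
  imports Defs
begin

text \<open>
  Place \<open>N = w ^ D\<close> cliques on a line, consecutive ones completely joined, where
  \<open>w = k / (4 D \<alpha>)\<close>, and add shortcuts that clear the last nonzero base-\<open>w\<close> digit of a
  position. At most \<open>D\<close> shortcuts lead from any position to \<open>0\<close>, but every position is jumped
  over by at most \<open>D (w - 1)\<close> shortcuts. An edge lies in at most two edge-independent trees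
  (one per direction towards the root), so for each position more than half of the
  \<open>4 D w\<close> trees contain no shortcut over it. By averaging, some tree has this property for more
  than \<open>N / 2\<close> positions, and its path between the two ends of the line must visit all of them.
\<close>

section \<open>Walks as powers of a relation\<close>

text \<open>Loops let a walk pause, so the \<open>l\<close>-th power of the relation captures walks
  of length at most \<open>l\<close>.\<close>

definition arcs :: "'a graph \<Rightarrow> ('a \<times> 'a) set" where
  "arcs G = {(x, y). x \<in> verts G \<and> y \<in> verts G \<and> (x = y \<or> {x, y} \<in> edges G)}"

lemma sym_arcs: "sym (arcs G)"
  by (auto simp: arcs_def sym_def insert_commute)

lemma sym_relpow:
  assumes "sym R"
  shows "sym (R ^^ l)"
proof (induction l)
  case (Suc l)
  show ?case
  proof (rule symI)
    fix x y assume "(x, y) \<in> R ^^ Suc l"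
    then obtain z where "(x, z) \<in> R" "(z, y) \<in> R ^^ l" by (blast dest: relpow_Suc_D2)
    then have "(y, z) \<in> R ^^ l" "(z, x) \<in> R"
      using symD[OF assms] symD[OF Suc] by blast+
    then show "(y, x) \<in> R ^^ Suc l" by (rule relpow_Suc_I)
  qed
qed (auto simp: sym_def)

lemma is_path_take:
  assumes "is_path G u p v" "i < length p"
  shows "is_path G u (take (Suc i) p) (p ! i)"
proof -
  have "p \<noteq> []" using assms by auto
  moreover have "last (take (Suc i) p) = p ! i"
    using assms(2) by (simp add: take_Suc_conv_app_nth)
  moreover have "successively (\<lambda>x y. {x, y} \<in> edges G) (take (Suc i) p)"
    using assms(1) unfolding is_path_def
    by (metis append_take_drop_id successively_append_iff)
  ultimately show ?thesis
    using assms set_take_subset[of "Suc i" p] by (auto simp: is_path_def hd_take)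
qed

text \<open>A walk becomes a path step by step: if the next vertex is already on the path, the path
  is cut off there; otherwise the vertex is appended.\<close>

lemma relpow_arcs_path:
  assumes "(u, v) \<in> arcs G ^^ l" "u \<in> verts G"
  shows "\<exists>p. is_path G u p v \<and> length p \<le> Suc l"
  using assms(1)
proof (induction l arbitrary: v)
  case 0
  then show ?case using assms(2) by (intro exI[of _ "[u]"]) (auto simp: is_path_def)
next
  case (Suc l)
  then obtain y where "(u, y) \<in> arcs G ^^ l" and y: "(y, v) \<in> arcs G" by auto
  then obtain p where p: "is_path G u p y" "length p \<le> Suc l" using Suc.IH by blast
  show ?case
  proof (cases "v \<in> set p")
    case True
    then obtain i where "i < length p" "p ! i = v" by (auto simp: in_set_conv_nth)
    with is_path_take[OF p(1)] p(2) show ?thesis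
      by (intro exI[of _ "take (Suc i) p"]) auto
  next
    case False
    then have "is_path G u (p @ [v]) v"
      using p(1) y by (auto simp: is_path_def arcs_def successively_append_iff)
    with p(2) show ?thesis by (intro exI[of _ "p @ [v]"]) auto
  qed
qed

lemma graph_dist_le:
  assumes "(u, v) \<in> arcs G ^^ l" "u \<in> verts G"
  shows "graph_dist G u v \<le> enat l"
proof -
  obtain p where p: "is_path G u p v" "length p \<le> Suc l"
    using relpow_arcs_path[OF assms] by blast
  have "graph_dist G u v \<le> enat (length p - 1)"
    unfolding graph_dist_def using p(1) by (intro INF_lower) auto
  also have "\<dots> \<le> enat l" using p(2) by simp
  finally show ?thesis .
qed

lemma connected_graphI:
  assumes "r \<in> verts G" "\<And>u. u \<in> verts G \<Longrightarrow> (r, u) \<in> (arcs G)\<^sup>*"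
  shows "connected_graph G"
  unfolding connected_graph_def
proof (intro conjI ballI)
  fix u v assume uv: "u \<in> verts G" "v \<in> verts G"
  have "(u, r) \<in> (arcs G)\<^sup>*" using assms(2)[OF uv(1)] sym_rtrancl[OF sym_arcs] by (metis symD)
  with assms(2)[OF uv(2)] have "(u, v) \<in> (arcs G)\<^sup>*" by (metis rtrancl_trans)
  then show "\<exists>p. is_path G u p v"
    using relpow_arcs_path uv(1) by (metis rtrancl_imp_relpow)
qed (use assms(1) in auto)

section \<open>Congestion of edge-independent trees\<close>

lemma path_edges_Cons: "path_edges (u # v # p) = insert {u, v} (path_edges (v # p))"
proof -
  have "path_edges (u # v # p) = {{(u # v # p) ! i, (u # v # p) ! Suc i} | i. i < Suc (length p)}"
    by (auto simp: path_edges_def)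
  also have "\<dots> = (\<lambda>i. {(u # v # p) ! i, (u # v # p) ! Suc i}) ` {..<Suc (length p)}"
    by auto
  also have "\<dots> = insert {u, v} ((\<lambda>i. {(v # p) ! i, (v # p) ! Suc i}) ` {..<length p})"
    by (simp only: lessThan_Suc_eq_insert_0) (simp add: image_image)
  also have "\<dots> = insert {u, v} (path_edges (v # p))"
    by (auto simp: path_edges_def)
  finally show ?thesis .
qed

text \<open>Orient an edge of a tree towards the root: it is the first edge of the root path of one
  of its end points.\<close>

lemma tree_edge_on_root_path:
  assumes "is_tree T" "{u, v} \<in> edges T" "r \<in> verts T"
  shows "\<exists>x\<in>{u, v}. \<exists>p. is_path T x p r \<and> {u, v} \<in> path_edges p"
proof -
  have uv: "u \<in> verts T" "v \<in> verts T" "u \<noteq> v"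
    using assms(1,2) by (auto simp: is_tree_def simple_graph_def)
  obtain p where p: "is_path T u p r"
    using assms uv by (auto simp: is_tree_def connected_graph_def)
  show ?thesis
  proof (cases "v \<in> set p")
    case False
    obtain q where q: "p = u # q" using p by (cases p) (auto simp: is_path_def)
    have "is_path T v (v # p) r"
      using p False uv assms(2) q by (auto simp: is_path_def insert_commute)
    moreover have "{u, v} \<in> path_edges (v # p)" by (simp add: q path_edges_Cons insert_commute)
    ultimately show ?thesis by blast
  next
    case True
    then obtain i where i: "i < length p" "p ! i = v" by (auto simp: in_set_conv_nth)
    \<comment> \<open>The edge closes this prefix of \<open>p\<close> to a cycle unless the prefix
      has at most two vertices, so \<open>v\<close> comes directly after \<open>u\<close> on
      \<open>p\<close>.\<close>
    have "is_path T u (take (Suc i) p) v" using is_path_take[OF p i(1)] i(2) by simp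
    moreover have "{v, u} \<in> edges T" using assms(2) by (simp add: insert_commute)
    ultimately have "\<not> length (take (Suc i) p) \<ge> 3"
      using assms(1) unfolding is_tree_def acyclic_graph_def by blast
    moreover have "p ! 0 = u" using p by (auto simp: is_path_def hd_conv_nth)
    ultimately have "i = 1" using i uv(3) by (cases i) auto
    then have "{u, v} \<in> path_edges p"
      using i \<open>p ! 0 = u\<close> by (auto simp: path_edges_def intro!: exI[of _ 0])
    with p show ?thesis by blast
  qed
qed

text \<open>Each tree through the edge has it on the root path of \<open>u\<close> or of
  \<open>v\<close>. Root paths from one vertex are edge-disjoint, so each end accounts for at most
  one tree.\<close>

lemma edge_independent_congestion:
  assumes "edge_independent_spanning_trees G I T" "finite I"
  shows "card {i \<in> I. {u, v} \<in> edges (T i)} \<le> 2"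
proof (cases "{i \<in> I. {u, v} \<in> edges (T i)} = {}")
  case False
  obtain r where r: "r \<in> verts G" and
    ind: "\<And>x i j p q. \<lbrakk>x \<in> verts G; i \<in> I; j \<in> I; i \<noteq> j; is_path (T i) x p r; is_path (T j) x q r\<rbrakk>
      \<Longrightarrow> path_edges p \<inter> path_edges q = {}"
    using assms(1) unfolding edge_independent_spanning_trees_def by meson
  have tree: "is_tree (T i)" "verts (T i) = verts G" if "i \<in> I" for i
    using that assms(1) by (auto simp: edge_independent_spanning_trees_def is_spanning_tree_def)
  define A where "A x = {i \<in> I. \<exists>p. is_path (T i) x p r \<and> {u, v} \<in> path_edges p}" for x
  have A1: "card (A x) \<le> 1" if "x \<in> verts G" for x
  proof -
    have "finite (A x)" using assms(2) by (simp add: A_def)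
    moreover have "i = j" if "i \<in> A x" "j \<in> A x" for i j
      using ind[OF \<open>x \<in> verts G\<close>] that unfolding A_def by blast
    ultimately show ?thesis by (simp add: card_le_Suc0_iff_eq)
  qed
  have uv: "u \<in> verts G" "v \<in> verts G"
  proof -
    obtain i where i: "i \<in> I" "{u, v} \<in> edges (T i)" using False by blast
    then have "{u, v} \<subseteq> verts (T i)"
      using tree(1)[OF i(1)] unfolding is_tree_def simple_graph_def by blast
    then show "u \<in> verts G" "v \<in> verts G" using tree(2)[OF i(1)] by auto
  qed
  have "{i \<in> I. {u, v} \<in> edges (T i)} \<subseteq> A u \<union> A v"
  proof
    fix i assume i: "i \<in> {i \<in> I. {u, v} \<in> edges (T i)}"
    then have "is_tree (T i)" "{u, v} \<in> edges (T i)" "r \<in> verts (T i)" using tree r by auto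
    from tree_edge_on_root_path[OF this] i show "i \<in> A u \<union> A v" by (auto simp: A_def)
  qed
  then have "card {i \<in> I. {u, v} \<in> edges (T i)} \<le> card (A u \<union> A v)"
    using assms(2) by (intro card_mono) (auto simp: A_def)
  also have "\<dots> \<le> card (A u) + card (A v)" by (rule card_Un_le)
  also have "\<dots> \<le> 2" using A1[OF uv(1)] A1[OF uv(2)] by simp
  finally show ?thesis .
next
  case True
  show ?thesis unfolding True by simp
qed

text \<open>As long as \<open>x\<close> has not been hit, the current value is below
  \<open>x\<close>, and one step cannot lead from below \<open>x\<close> to above it.\<close>

lemma list_discrete_ivt:
  fixes g :: "'a \<Rightarrow> nat"
  assumes "p \<noteq> []" "g (hd p) \<le> x" "x \<le> g (last p)"
    and "successively (\<lambda>a b. \<not> (g a < x \<and> x < g b)) p"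
  shows "x \<in> g ` set p"
  using assms
proof (induction p)
  case (Cons a p)
  show ?case
  proof (cases "p = [] \<or> g a = x")
    case False
    with Cons show ?thesis by (auto simp: successively_Cons)
  qed (use Cons in auto)
qed simp

text \<open>
  The line consists of \<open>w ^ D\<close> groups of at least \<open>3 * k\<close> vertices (the last one absorbs the
  surplus); the first vertex of each group is its hub. In \<open>shortcut a b\<close>, the digit \<open>d\<close> at place
  \<open>j\<close> is the last nonzero base-\<open>w\<close> digit of \<open>b\<close>. Groups of size \<open>3 * k\<close> give two vertices at
  least \<open>k\<close> common neighbours, whence the edge-connectivity.
\<close>

locale shortcut_line =
  fixes w D k n :: nat
  assumes w: "w \<ge> 2" and k: "k > 0" and n: "n \<ge> 3 * k * w ^ D"
begin

definition grp :: "nat \<Rightarrow> nat" where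
  "grp v = min (v div (3 * k)) (w ^ D - 1)"

definition hub :: "nat \<Rightarrow> nat" where
  "hub x = 3 * k * x"

definition shortcut :: "nat \<Rightarrow> nat \<Rightarrow> bool" where
  "shortcut a b \<longleftrightarrow> (\<exists>j<D. \<exists>d\<in>{1..<w}. w ^ Suc j dvd a \<and> b = a + d * w ^ j \<and> b < w ^ D)"

definition adj :: "nat \<Rightarrow> nat \<Rightarrow> bool" where
  "adj u v \<longleftrightarrow> (grp u \<le> Suc (grp v) \<and> grp v \<le> Suc (grp u)) \<or>
     (\<exists>a b. shortcut a b \<and> {u, v} = {hub a, hub b})"

definition G :: "nat graph" where
  "G = \<lparr>verts = {..<n}, edges = {{u, v} | u v. u < n \<and> v < n \<and> u \<noteq> v \<and> adj u v}\<rparr>"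

lemma adj_sym: "adj u v \<longleftrightarrow> adj v u"
  by (auto simp: adj_def insert_commute)

lemma verts_G [simp]: "verts G = {..<n}"
  by (simp add: G_def)

lemma edge_G_iff: "{u, v} \<in> edges G \<longleftrightarrow> u < n \<and> v < n \<and> u \<noteq> v \<and> adj u v"
  using adj_sym by (auto simp: G_def doubleton_eq_iff)

lemma pow_pos: "w ^ D > 0"
  using w by simp

lemma grp_less: "grp v < w ^ D"
  using diff_less[OF zero_less_one pow_pos] by (simp only: grp_def min_less_iff_disj simp_thms)

lemma hub_less: "x < w ^ D \<Longrightarrow> hub x < n"
  using n k by (metis hub_def less_le_trans mult_less_mono2 nat_0_less_mult_iff zero_less_numeral)

lemma grp_hub: "x < w ^ D \<Longrightarrow> grp (hub x) = x"
  using k by (simp add: grp_def hub_def)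

lemma n_pos: "n > 0"
  using hub_less[OF grp_less] by (metis not_gr_zero not_less_zero)

lemma grp_0: "grp 0 = 0"
  by (simp add: grp_def)

lemma grp_last: "grp (n - 1) = w ^ D - 1"
proof -
  have "3 * k * (w ^ D - 1) = 3 * k * w ^ D - 3 * k" by (simp add: diff_mult_distrib2)
  then have "3 * k * (w ^ D - 1) \<le> n - 1" using n k pow_pos by simp
  then have "w ^ D - 1 \<le> (n - 1) div (3 * k)"
    using k by (simp add: less_eq_div_iff_mult_less_eq mult.commute)
  then show ?thesis by (simp add: grp_def)
qed

lemma card_group:
  assumes "x < w ^ D"
  shows "3 * k \<le> card {v \<in> {..<n}. grp v = x}"
proof -
  have "{hub x..<hub x + 3 * k} \<subseteq> {v \<in> {..<n}. grp v = x}"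
  proof
    fix v assume "v \<in> {hub x..<hub x + 3 * k}"
    then have v: "3 * k * x \<le> v" "v < 3 * k * Suc x" by (auto simp: hub_def)
    then have "v div (3 * k) = x" using k by (metis div_nat_eqI mult.commute)
    moreover have "3 * k * Suc x \<le> 3 * k * w ^ D" using assms by (intro mult_le_mono2) simp
    ultimately show "v \<in> {v \<in> {..<n}. grp v = x}" using v n assms by (auto simp: grp_def)
  qed
  from card_mono[OF _ this] show ?thesis by simp
qed

lemma simple_G: "simple_graph G"
  by (auto simp: simple_graph_def G_def)

section \<open>Edge-connectivity\<close>

lemma connected_delete_step:
  assumes F: "F \<subseteq> edges G" "card F < k" and uv: "u < n" "v < n"
    and near: "grp u \<le> Suc (grp v)" "grp v \<le> Suc (grp u)"
  shows "(u, v) \<in> (arcs (G\<lparr>edges := edges G - F\<rparr>))\<^sup>*"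
proof (cases "u = v")
  case False
  have "finite (edges G)"
    by (rule finite_subset[of _ "Pow {..<n}"]) (auto simp: G_def)
  then have finF: "finite F" using F(1) finite_subset by blast
  define Z where "Z = {z \<in> {..<n}. grp z = grp u} - {u, v}"
  have "3 * k - 2 \<le> card Z"
    using diff_card_le_card_Diff[of "{u, v}" "{z \<in> {..<n}. grp z = grp u}"] card_group[OF grp_less[of u]] False
    unfolding Z_def by simp
  with F(2) k have cZ: "card F < card Z" by simp
  \<comment> \<open>\<open>f z\<close> lies in \<open>F\<close> exactly if the detour through
    \<open>z\<close> is broken. As \<open>f\<close> is injective on \<open>Z\<close> and
    \<open>F\<close> is smaller than \<open>Z\<close>, some detour survives.\<close>
  define f where "f z = (if {u, z} \<in> F then {u, z} else {v, z})" for z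
  have "inj_on f Z"
    by (rule inj_onI) (use False in \<open>auto simp: f_def Z_def doubleton_eq_iff split: if_splits\<close>)
  then have "\<not> f ` Z \<subseteq> F"
    using cZ finF by (metis card_image card_mono not_le)
  then obtain z where z: "z \<in> Z" "{u, z} \<notin> F" "{v, z} \<notin> F"
    by (auto simp: f_def split: if_splits)
  have "(u, z) \<in> arcs (G\<lparr>edges := edges G - F\<rparr>)"
    using z uv near by (auto simp: arcs_def edge_G_iff Z_def adj_def)
  moreover have "(z, v) \<in> arcs (G\<lparr>edges := edges G - F\<rparr>)"
    using z uv near by (auto simp: arcs_def edge_G_iff Z_def adj_def insert_commute)
  ultimately show ?thesis by (meson r_into_rtrancl rtrancl_trans)
qed simp

lemma edge_connected_G: "edge_connected k G"
  unfolding edge_connected_def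
proof (intro allI impI)
  fix F assume "F \<subseteq> edges G \<and> card F < k"
  then have F: "F \<subseteq> edges G" "card F < k" by auto
  note step = connected_delete_step[OF F]
  have hubs: "(hub 0, hub x) \<in> (arcs (G\<lparr>edges := edges G - F\<rparr>))\<^sup>*" if "x < w ^ D" for x
    using that
  proof (induction x)
    case (Suc x)
    then have "(hub x, hub (Suc x)) \<in> (arcs (G\<lparr>edges := edges G - F\<rparr>))\<^sup>*"
      by (intro step) (auto simp: hub_less grp_hub)
    with Suc show ?case by (meson Suc_lessD rtrancl_trans)
  qed simp
  show "connected_graph (G\<lparr>edges := edges G - F\<rparr>)"
  proof (rule connected_graphI)
    show "hub 0 \<in> verts (G\<lparr>edges := edges G - F\<rparr>)" using hub_less pow_pos by simp
    fix u assume "u \<in> verts (G\<lparr>edges := edges G - F\<rparr>)"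
    then have "(hub (grp u), u) \<in> (arcs (G\<lparr>edges := edges G - F\<rparr>))\<^sup>*"
      by (intro step) (auto simp: hub_less grp_hub grp_less)
    with hubs[OF grp_less] show "(hub 0, u) \<in> (arcs (G\<lparr>edges := edges G - F\<rparr>))\<^sup>*"
      by (rule rtrancl_trans)
  qed
qed

section \<open>Diameter of the graph\<close>

text \<open>With the last \<open>j\<close> digits already cleared, digit \<open>j\<close> is either
  zero, which costs a loop, or the last nonzero digit, which a shortcut clears.\<close>

lemma clear_digit_arc:
  assumes "x < w ^ D" "j < D"
  shows "(hub (x div w ^ j * w ^ j), hub (x div w ^ Suc j * w ^ Suc j)) \<in> arcs G"
proof -
  define a where "a = x div w ^ Suc j * w ^ Suc j"
  define b where "b = x div w ^ j * w ^ j"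
  define d where "d = x div w ^ j mod w"
  have "x div w ^ j = x div w ^ Suc j * w + d"
    unfolding d_def by (metis div_mult2_eq div_mult_mod_eq mult.commute power_Suc)
  then have b: "b = a + d * w ^ j"
    by (simp add: a_def b_def algebra_simps)
  have "b \<le> x" by (simp add: b_def)
  then have ab: "a < w ^ D" "b < w ^ D" using b assms(1) by auto
  have "d < w" using w by (simp add: d_def)
  have "adj (hub b) (hub a)" if "d \<noteq> 0"
  proof -
    have "shortcut a b"
      unfolding shortcut_def using assms(2) b ab \<open>d < w\<close> that
      by (intro exI[of _ j] conjI bexI[of _ d]) (auto simp: a_def)
    then show ?thesis by (auto simp: adj_def)
  qed
  then have "(hub b, hub a) \<in> arcs G"
    using b ab by (cases "d = 0") (auto simp: arcs_def edge_G_iff hub_less)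
  then show ?thesis by (simp add: a_def b_def)
qed

lemma relpow_hub:
  assumes "x < w ^ D"
  shows "(hub x, hub 0) \<in> arcs G ^^ D"
proof -
  have "(hub x, hub (x div w ^ j * w ^ j)) \<in> arcs G ^^ j" if "j \<le> D" for j
    using that
  proof (induction j)
    case (Suc j)
    then show ?case using clear_digit_arc[OF assms, of j] by (meson Suc_le_lessD less_imp_le relpow_Suc_I)
  qed simp
  from this[of D] assms show ?thesis by simp
qed

lemma relpow_0:
  assumes "v < n"
  shows "(v, hub 0) \<in> arcs G ^^ Suc D"
proof -
  have "(v, hub (grp v)) \<in> arcs G"
    using assms by (auto simp: arcs_def edge_G_iff hub_less grp_hub grp_less adj_def)
  then show ?thesis using relpow_hub[OF grp_less] by (meson relpow_Suc_I2)
qed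

text \<open>Both ends reach \<open>hub 0\<close> by one arc to the hub of their group and
  \<open>D\<close> digit clearings.\<close>

lemma diameter_G: "graph_diameter G \<le> enat (2 * D + 2)"
  unfolding graph_diameter_def
proof (intro SUP_least)
  fix u v assume uv: "u \<in> verts G" "v \<in> verts G"
  then have "(u, hub 0) \<in> arcs G ^^ Suc D" "(v, hub 0) \<in> arcs G ^^ Suc D"
    using relpow_0 by (simp_all only: verts_G lessThan_iff)
  moreover from this(2) have "(hub 0, v) \<in> arcs G ^^ Suc D"
    by (rule symD[OF sym_relpow[OF sym_arcs]])
  ultimately have "(u, v) \<in> arcs G ^^ (Suc D + Suc D)"
    unfolding relpow_add by blast
  from graph_dist_le[OF this uv(1)] show "graph_dist G u v \<le> enat (2 * D + 2)"
    by (simp add: mult_2)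
qed

section \<open>Shortcuts over a position\<close>

definition jumps :: "nat \<Rightarrow> nat set set" where
  "jumps x = {{u, v} | u v. {u, v} \<in> edges G \<and> grp u < x \<and> x < grp v}"

text \<open>A shortcut at digit \<open>j\<close> over \<open>x\<close> starts at \<open>x\<close> with its last \<open>j + 1\<close> digits cleared,
  so it is determined by \<open>j\<close> and the digit \<open>d\<close>.\<close>

lemma jumps_subset:
  "jumps x \<subseteq> (\<lambda>(j, d). {hub (x div w ^ Suc j * w ^ Suc j), hub (x div w ^ Suc j * w ^ Suc j + d * w ^ j)})
     ` ({..<D} \<times> {1..<w})"
proof
  fix e assume "e \<in> jumps x"
  then obtain u v where e: "e = {u, v}" "adj u v" "grp u < x" "x < grp v"
    by (auto simp: jumps_def edge_G_iff)
  \<comment> \<open>The two groups lie strictly on either side of \<open>x\<close>, hence are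
    neither equal nor consecutive.\<close>
  then obtain a b where ab: "shortcut a b" "e = {hub a, hub b}"
    by (auto simp: adj_def)
  then obtain j d where jd: "j < D" "d \<in> {1..<w}" "w ^ Suc j dvd a" "b = a + d * w ^ j" "b < w ^ D"
    by (auto simp: shortcut_def)
  then have "grp (hub a) = a" "grp (hub b) = b" "a \<le> b" by (auto simp: grp_hub)
  with e ab have x: "a < x" "x < b" by (auto simp: doubleton_eq_iff)
  obtain q where q: "a = w ^ Suc j * q" using jd(3) by auto
  \<comment> \<open>Hence \<open>x\<close> lies in the block of length \<open>w ^ Suc j\<close> that
    starts at \<open>a\<close>, and division recovers \<open>a\<close> from
    \<open>x\<close>.\<close>
  have "d * w ^ j \<le> w ^ Suc j" using jd(2) by simp
  with x jd(4) q have "w ^ Suc j * q \<le> x" "x < w ^ Suc j * Suc q"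
    unfolding mult_Suc_right by linarith+
  then have "x div w ^ Suc j = q" by (metis div_nat_eqI mult.commute)
  then have "a = x div w ^ Suc j * w ^ Suc j" using q by simp
  with jd ab(2) show "e \<in> (\<lambda>(j, d). {hub (x div w ^ Suc j * w ^ Suc j),
      hub (x div w ^ Suc j * w ^ Suc j + d * w ^ j)}) ` ({..<D} \<times> {1..<w})"
    by (intro image_eqI[of _ _ "(j, d)"]) auto
qed

lemma finite_jumps: "finite (jumps x)"
  by (rule finite_subset[OF jumps_subset]) simp

lemma card_jumps: "card (jumps x) \<le> D * (w - 1)"
  using surj_card_le[OF _ jumps_subset] by (simp add: card_cartesian_product)

text \<open>A path from vertex \<open>0\<close> in the first group to vertex \<open>n - 1\<close> in
  the last one meets the group of every position that no edge of \<open>H\<close> jumps over.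
  Distinct groups need distinct vertices, and a path has one edge fewer than vertices.\<close>

lemma diameter_ge_unjumped:
  assumes "verts H = verts G" "edges H \<subseteq> edges G"
  shows "enat (card {x \<in> {..<w ^ D}. jumps x \<inter> edges H = {}} - 1) \<le> graph_diameter H"
    (is "enat (card ?X - 1) \<le> _")
proof -
  have "enat (card ?X - 1) \<le> graph_dist H 0 (n - 1)"
    unfolding graph_dist_def
  proof (intro INF_greatest)
    fix p assume "p \<in> {p. is_path H 0 p (n - 1)}"
    then have p: "p \<noteq> []" "hd p = 0" "last p = n - 1" "successively (\<lambda>x y. {x, y} \<in> edges H) p"
      by (auto simp: is_path_def)
    have "?X \<subseteq> grp ` set p"
    proof
      fix x assume x: "x \<in> ?X"
      have "successively (\<lambda>a b. \<not> (grp a < x \<and> x < grp b)) p"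
        by (rule successively_mono[OF p(4)]) (use x assms(2) in \<open>auto simp: jumps_def\<close>)
      then show "x \<in> grp ` set p"
        by (intro list_discrete_ivt) (use p x grp_last in \<open>auto simp: grp_0\<close>)
    qed
    then have "card ?X \<le> card (set p)" by (rule surj_card_le[rotated]) simp
    also have "\<dots> \<le> length p" by (rule card_length)
    finally show "enat (card ?X - 1) \<le> enat (length p - 1)" by simp
  qed
  also have "\<dots> \<le> graph_diameter H"
    unfolding graph_diameter_def
    by (rule SUP_upper2[of 0], simp add: assms(1) n_pos, rule SUP_upper) (simp add: assms(1) n_pos)
  finally show ?thesis .
qed

section \<open>Averaging over the trees\<close>

lemma large_diameter_tree:
  assumes T: "edge_independent_spanning_trees G I T" and I: "finite I" "card I = 4 * D * w"
    and D: "D > 0"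
  shows "\<exists>i\<in>I. enat (w ^ D div 2) \<le> graph_diameter (T i)"
proof (rule ccontr)
  assume small: "\<not> ?thesis"
  define good where "good x i \<longleftrightarrow> jumps x \<inter> edges (T i) = {}" for x i
  have tree: "verts (T i) = verts G" "edges (T i) \<subseteq> edges G" if "i \<in> I" for i
    using that T by (auto simp: edge_independent_spanning_trees_def is_spanning_tree_def)
  have few: "2 * card {x \<in> {..<w ^ D}. good x i} \<le> w ^ D" if i: "i \<in> I" for i
  proof -
    have "enat (card {x \<in> {..<w ^ D}. good x i} - 1) < enat (w ^ D div 2)"
      using diameter_ge_unjumped[OF tree[OF i]] small i unfolding good_def
      by (meson le_less_trans not_le)
    then show ?thesis by simp
  qed
  \<comment> \<open>At most \<open>D * (w - 1)\<close> edges jump over \<open>x\<close>, each in at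
    most two trees. So strictly fewer than half of the \<open>4 * D * w\<close> trees are bad for
    \<open>x\<close>.\<close>
  have many: "2 * D * w < card {i \<in> I. good x i}" for x
  proof -
    have "{i \<in> I. \<not> good x i} = (\<Union>e\<in>jumps x. {i \<in> I. e \<in> edges (T i)})"
      by (auto simp: good_def)
    then have "card {i \<in> I. \<not> good x i} \<le> (\<Sum>e\<in>jumps x. card {i \<in> I. e \<in> edges (T i)})"
      by (simp only: card_UN_le[OF finite_jumps])
    also have "\<dots> \<le> (\<Sum>e\<in>jumps x. 2)"
      using edge_independent_congestion[OF T I(1)] by (intro sum_mono) (auto simp: jumps_def)
    also have "\<dots> \<le> 2 * (D * (w - 1))" using card_jumps[of x] by simp
    also have "\<dots> < 2 * D * w" using D w by simp
    finally have "card {i \<in> I. \<not> good x i} < 2 * D * w" .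
    moreover have "card I = card {i \<in> I. good x i} + card {i \<in> I. \<not> good x i}"
      using I(1) by (subst card_Un_disjoint[symmetric]) (auto intro!: arg_cong[of _ _ card])
    ultimately show ?thesis using I(2) by simp
  qed
  \<comment> \<open>Double counting of the good pairs: by \<open>many\<close> they are more than
    half of all pairs, by \<open>few\<close> at most half.\<close>
  have "w ^ D * (2 * D * w) = (\<Sum>x<w ^ D. 2 * D * w)" by simp
  also have "\<dots> < (\<Sum>x<w ^ D. card {i \<in> I. good x i})"
    by (rule sum_strict_mono[OF finite_lessThan _ many]) (use pow_pos in blast)
  also have "\<dots> = (\<Sum>i\<in>I. card {x \<in> {..<w ^ D}. good x i})"
    by (rule sum_multicount_gen) (auto simp: I(1))
  finally have "2 * (w ^ D * (2 * D * w)) < (\<Sum>i\<in>I. 2 * card {x \<in> {..<w ^ D}. good x i})"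
    unfolding sum_distrib_left[symmetric] by linarith
  also have "\<dots> \<le> (\<Sum>i\<in>I. w ^ D)" using few by (rule sum_mono)
  also have "\<dots> = 2 * (w ^ D * (2 * D * w))" using I(2) by simp
  finally show False by simp
qed

end

section \<open>Choice of the parameters\<close>

theorem mainTheorem4:
  fixes n k D \<alpha> :: nat
  assumes "n > 0" and "k > 0" and "D > 0" and "\<alpha> > 0"
    and "8 * D * \<alpha> dvd k"
    and "real n \<ge> 3 * real k * (real k / (4 * real D * real \<alpha>)) ^ D"
  shows "\<exists>G :: nat graph.
    simple_graph G \<and> edge_connected k G \<and> card (verts G) = n \<and>
    graph_diameter G \<le> enat (2 * D + 2) \<and>
    (\<forall>T :: nat \<Rightarrow> nat graph. edge_independent_spanning_trees G {1..k div \<alpha>} T \<longrightarrow>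
       (\<exists>i\<in>{1..k div \<alpha>}.
          ereal_of_enat (graph_diameter (T i))
            \<ge> ereal (1 / 4 * (real k / (4 * real D * real \<alpha>)) ^ D)))"
proof -
  obtain c where c: "k = 8 * D * \<alpha> * c" using assms(5) by auto
  \<comment> \<open>This is \<open>k / (4 * D * \<alpha>)\<close>. Divisibility by 8 instead of 4
    makes it even, so it is a base of at least 2.\<close>
  define w where "w = 2 * c"
  have kw: "real k / (4 * real D * real \<alpha>) = real w" "k div \<alpha> = 4 * D * w"
    using assms(3,4) by (auto simp: c w_def)
  have w: "w \<ge> 2" using c assms(2) by (cases c) (auto simp: w_def)
  have "real (3 * k * w ^ D) \<le> real n" using assms(6) kw(1) by simp
  then interpret shortcut_line w D k n
    using w assms(2) by unfold_locales (simp_all only: of_nat_le_iff)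
  show ?thesis
  proof (intro exI[of _ G] conjI allI impI)
    fix T :: "nat \<Rightarrow> nat graph"
    assume "edge_independent_spanning_trees G {1..k div \<alpha>} T"
    from large_diameter_tree[OF this] kw(2) assms(3) obtain i where
      i: "i \<in> {1..k div \<alpha>}" "enat (w ^ D div 2) \<le> graph_diameter (T i)" by auto
    \<comment> \<open>The factor 1/4 in place of 1/2 absorbs the rounding in
      \<open>w ^ D div 2\<close>.\<close>
    have "w ^ D \<ge> 2" using w assms(3) self_le_power[of w D] by linarith
    then have "w ^ D \<le> 4 * (w ^ D div 2)" by presburger
    then have "real (w ^ D) \<le> real (4 * (w ^ D div 2))" by (rule of_nat_mono)
    then have "ereal (1 / 4 * real w ^ D) \<le> ereal_of_enat (enat (w ^ D div 2))" by simp
    also have "\<dots> \<le> ereal_of_enat (graph_diameter (T i))"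
      using i(2) by (simp only: ereal_of_enat_le_iff)
    finally show "\<exists>i\<in>{1..k div \<alpha>}. ereal_of_enat (graph_diameter (T i))
        \<ge> ereal (1 / 4 * (real k / (4 * real D * real \<alpha>)) ^ D)"
      using i(1) kw(1) by (intro bexI[of _ i]) auto
  qed (use simple_G edge_connected_G diameter_G in auto)
qed

end
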